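(* Let $r\ge 3$ and let $q$ be a prime power. Any Singer cover of $\mathrm{PG}(r,q)$ is an $(r-2)$-dual cover of $\mathrm{PG}(r,q)$.
   Context: An $n$-space is an $n$-dimensional projective subspace. $\theta_{n,q}=q^n+\dots+q+1$ for $n\ge 0$ and $\theta_{-1,q}=0$. An $m$-cover of lines of $\mathrm{PG}(r,q)$ is a set $\mathcal L$ of lines such that every point of $\mathrm{PG}(r,q)$ lies on exactly $m$ lines of $\mathcal L$, where $0<m<\theta_{r-1,q}$. An $m$-cover $\mathcal L$ is an $(r-2)$-dual $m$-cover (or $(r-2)$-dual cover) if every $(r-2)$-space of $\mathrm{PG}(r,q)$ contains either $\frac{m\theta_{r-4,q}}{q+1}+q^{r-3}$ or $\frac{m\theta_{r-4,q}}{q+1}$ lines of $\mathcal L$. A Singer cyclic group of $\mathrm{PG}(r,q)$ is a cyclic subgroup $\mathcal K$ of $\mathrm{PGL}(r+1,q)$ acting regularly on the points of $\mathrm{PG}(r,q)$. A Singer cover of $\mathrm{PG}(r,q)$ is an orbit of $\mathcal K$ on the lines of $\mathrm{PG}(r,q)$. (It is known that if $r$ is odd, one $\mathcal K$-orbit on lines is a $1$-cover and every other one is a $(q+1)$-cover, and if $r$ is even every $\mathcal K$-orbit on lines is a $(q+1)$-cover; $m$ in the definition of $(r-2)$-dual is the corresponding value.) *)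

theory Defs
  imports
    "HOL-Analysis.Cartesian_Space"
    "HOL-Algebra.Elementary_Groups"
    "HOL-Algebra.Group_Action"
begin

text \<open>
  For a finite field \<^typ>\<open>'a\<close> with \<open>q\<close> elements and an index type \<^typ>\<open>'n\<close> with \<open>r + 1\<close> elements,
  \<open>PG(r,q)\<close> is the geometry of subspaces of \<^typ>\<open>'a^'n\<close>; its \<open>k\<close>-spaces are the linear subspaces
  of dimension \<open>k + 1\<close>, and incidence is inclusion. Definitions that take \<open>r\<close> and \<open>q\<close> as arguments
  are meant for \<open>r = CARD('n) - 1\<close> and \<open>q = CARD('a)\<close>.
\<close>

definition pg_spaces :: "nat \<Rightarrow> ('a::field ^ 'n::finite) set set"
  where "pg_spaces k = {W. vec.subspace W \<and> vec.dim W = k + 1}"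

abbreviation pg_points :: "('a::field ^ 'n::finite) set set"
  where "pg_points \<equiv> pg_spaces 0"

abbreviation pg_lines :: "('a::field ^ 'n::finite) set set"
  where "pg_lines \<equiv> pg_spaces 1"

text \<open>\<open>q\<^sup>n + \<dots> + q + 1\<close>; the index is an integer so that \<open>theta (- 1) q = 0\<close>.\<close>

definition theta :: "int \<Rightarrow> nat \<Rightarrow> nat"
  where "theta n q = (\<Sum>i<nat (n + 1). q ^ i)"

definition m_cover :: "nat \<Rightarrow> nat \<Rightarrow> nat \<Rightarrow> ('a::{field,finite} ^ 'n::finite) set set \<Rightarrow> bool"
  where "m_cover r q m L \<longleftrightarrow>
    L \<subseteq> pg_lines \<and> 0 < m \<and> m < theta (int r - 1) q \<and>
    (\<forall>P\<in>pg_points. card {l \<in> L. P \<subseteq> l} = m)"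

text \<open>For \<open>r \<ge> 3\<close>. The quotient is taken in the reals, not by truncating division.\<close>

definition dual_m_cover :: "nat \<Rightarrow> nat \<Rightarrow> nat \<Rightarrow> ('a::{field,finite} ^ 'n::finite) set set \<Rightarrow> bool"
  where "dual_m_cover r q m L \<longleftrightarrow>
    m_cover r q m L \<and>
    (\<forall>S\<in>pg_spaces (r - 2).
       real (card {l \<in> L. l \<subseteq> S}) =
         real m * real (theta (int r - 4) q) / (real q + 1) + real q ^ (r - 3) \<or>
       real (card {l \<in> L. l \<subseteq> S}) =
         real m * real (theta (int r - 4) q) / (real q + 1))"

text \<open>The number \<open>m\<close> is determined by \<open>L\<close>: it is the number of lines of \<open>L\<close> on any point.\<close>

definition dual_cover :: "nat \<Rightarrow> nat \<Rightarrow> ('a::{field,finite} ^ 'n::finite) set set \<Rightarrow> bool"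
  where "dual_cover r q L \<longleftrightarrow> (\<exists>m. dual_m_cover r q m L)"

definition GL :: "('a::field ^ 'n ^ 'n::finite) monoid"
  where "GL = \<lparr>carrier = {A. invertible A}, mult = (**), one = mat 1\<rparr>"

definition scalars :: "('a::field ^ 'n ^ 'n::finite) set"
  where "scalars = {mat c | c. c \<noteq> 0}"

definition PGL :: "('a::field ^ 'n ^ 'n::finite) set monoid"
  where "PGL = GL Mod scalars"

text \<open>
  The elements of \<^const>\<open>PGL\<close> are cosets of scalar matrices, and all matrices in such a coset map a
  given subspace to the same subspace; the union below is that common image (see \<open>pgl_act_coset\<close>).
\<close>

definition pgl_act :: "('a::field ^ 'n ^ 'n) set \<Rightarrow> ('a ^ 'n::finite) set \<Rightarrow> ('a ^ 'n) set"
  where "pgl_act C W = (\<Union>A\<in>C. (*v) A ` W)"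

definition singer_cyclic_group :: "('a::field ^ 'n ^ 'n::finite) set set \<Rightarrow> bool"
  where "singer_cyclic_group K \<longleftrightarrow>
    subgroup K PGL \<and> cyclic_group (PGL\<lparr>carrier := K\<rparr>) \<and>
    (\<forall>P\<in>pg_points. \<forall>Q\<in>pg_points. \<exists>!g. g \<in> K \<and> pgl_act g P = Q)"

definition singer_cover :: "('a::{field,finite} ^ 'n::finite) set set \<Rightarrow> bool"
  where "singer_cover L \<longleftrightarrow>
    (\<exists>K. singer_cyclic_group K \<and>
      (\<exists>l\<in>pg_lines. L = orbit (PGL\<lparr>carrier := K\<rparr>) pgl_act l))"

lemma group_GL: "Group.group (GL :: ('a::field ^ 'n ^ 'n::finite) monoid)"
proof (rule groupI)
  show "\<one>\<^bsub>GL\<^esub> \<in> carrier (GL :: ('a ^ 'n ^ 'n) monoid)"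
    by (simp add: GL_def invertible_def exI[of _ "mat 1"])
next
  fix A B :: "'a ^ 'n ^ 'n" assume "A \<in> carrier GL" "B \<in> carrier GL"
  then show "A \<otimes>\<^bsub>GL\<^esub> B \<in> carrier GL"
    by (simp add: GL_def invertible_mult)
next
  fix A :: "'a ^ 'n ^ 'n" assume "A \<in> carrier GL"
  then obtain B where "A ** B = mat 1" "B ** A = mat 1"
    by (auto simp: GL_def invertible_def)
  then show "\<exists>B\<in>carrier GL. B \<otimes>\<^bsub>GL\<^esub> A = \<one>\<^bsub>GL\<^esub>"
    by (intro bexI[of _ B]) (auto simp: GL_def invertible_def)
qed (simp_all add: GL_def matrix_mul_assoc)

lemma mat_mult_left: "mat c ** (A :: 'a::field ^ 'n ^ 'n::finite) = (\<chi> i j. c * A $ i $ j)"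
  by (simp add: matrix_matrix_mult_def mat_def vec_eq_iff if_distrib[of "\<lambda>x. x * y" for y] cong: if_cong)

lemma mat_mult_right: "(A :: 'a::field ^ 'n ^ 'n::finite) ** mat c = (\<chi> i j. c * A $ i $ j)"
  by (simp add: matrix_matrix_mult_def mat_def vec_eq_iff if_distrib[of "(*) y" for y] mult.commute cong: if_cong)

lemma mat_mult_mat: "mat c ** (mat d :: 'a::field ^ 'n ^ 'n::finite) = mat (c * d)"
  by (simp add: mat_mult_left) (simp add: mat_def vec_eq_iff)

lemma scalars_subset: "scalars \<subseteq> carrier (GL :: ('a::field ^ 'n ^ 'n::finite) monoid)"
proof -
  have "invertible (mat c :: 'a ^ 'n ^ 'n)" if "c \<noteq> 0" for c
    unfolding invertible_def using that
    by (intro exI[of _ "mat (inverse c)"]) (simp add: mat_mult_mat)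
  then show ?thesis by (auto simp: GL_def scalars_def)
qed

lemma normal_scalars: "scalars \<lhd> (GL :: ('a::field ^ 'n ^ 'n::finite) monoid)"
proof -
  interpret G: Group.group "GL :: ('a ^ 'n ^ 'n) monoid" by (rule group_GL)
  have sub: "subgroup scalars (GL :: ('a ^ 'n ^ 'n) monoid)"
  proof (rule G.subgroupI[OF scalars_subset])
    show "scalars \<noteq> ({} :: ('a ^ 'n ^ 'n) set)"
      by (auto simp: scalars_def intro: exI[of _ 1])
  next
    fix A :: "'a ^ 'n ^ 'n" assume A: "A \<in> scalars"
    then obtain c where c: "c \<noteq> 0" "A = mat c" by (auto simp: scalars_def)
    have B: "mat (inverse c) \<in> (scalars :: ('a ^ 'n ^ 'n) set)" using c by (auto simp: scalars_def)
    have "inv\<^bsub>GL\<^esub> A = mat (inverse c)"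
      using c A B scalars_subset
      by (intro G.inv_equality) (auto simp: GL_def mat_mult_mat)
    then show "inv\<^bsub>GL\<^esub> A \<in> scalars" using B by simp
  qed (auto simp: scalars_def GL_def mat_mult_mat)
  show ?thesis
  proof (rule G.normalI[OF sub], rule ballI)
    fix A :: "'a ^ 'n ^ 'n"
    show "scalars #>\<^bsub>GL\<^esub> A = A <#\<^bsub>GL\<^esub> scalars"
      by (auto simp: r_coset_def l_coset_def scalars_def GL_def mat_mult_left mat_mult_right)
  qed
qed

lemma group_PGL: "Group.group (PGL :: ('a::field ^ 'n ^ 'n::finite) set monoid)"
  unfolding PGL_def by (rule normal.factorgroup_is_group[OF normal_scalars])

lemma pgl_act_coset:
  fixes A :: "'a::field ^ 'n ^ 'n::finite"
  assumes "C \<in> carrier PGL" "A \<in> C" "vec.subspace W"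
  shows "pgl_act C W = (*v) A ` W"
proof -
  have mv: "(mat c ** B) *v x = B *v (c *s x)" for c :: 'a and B :: "'a ^ 'n ^ 'n" and x
    by (simp add: mat_mult_left matrix_vector_mult_def vec_eq_iff ac_simps)
  have sub: "(*v) (mat c ** B) ` W \<subseteq> (*v) B ` W" for c :: 'a and B :: "'a ^ 'n ^ 'n"
    using assms(3) by (auto simp: mv vec.subspace_scale)
  obtain B where B: "C = {mat c ** B | c. c \<noteq> 0}"
    using assms(1) by (auto simp: PGL_def carrier_FactGroup r_coset_def scalars_def GL_def)
  obtain c where c: "c \<noteq> 0" "A = mat c ** B" using assms(2) B by auto
  have "B = mat (inverse c) ** A"
    using c by (simp add: matrix_mul_assoc mat_mult_mat)
  then have "(*v) B ` W \<subseteq> (*v) A ` W" using sub by metis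
  then show ?thesis
    using sub assms(2) unfolding pgl_act_def B by blast
qed

end

(*
  The matrices lying over a Singer cyclic group K form a commutative group U that is regular on the
  nonzero vectors. Write the line l as span {u, s u} with s in U. For a subspace S, the M in U with
  M l inside S correspond, via M |-> M u, to the nonzero vectors of core s S = {x in S. s x in S}, so
  there are q^dim (core s S) - 1 of them; taking S = l gives the order of the stabilizer of l, by
  which all counts have to be divided. If S has codimension 2, then core s S has codimension at most
  2 in S. If s is not quadratic over the base field, then core s l is a point and core s S is never
  all of S, since otherwise s would satisfy the quadratic equation of its action on V/S. If s is
  quadratic, then l and core s S are s-invariant, and s-invariant subspaces have even dimension, so
  codimension 1 cannot occur.
*)
theory Submission
  imports Defs
begin

section \<open>Linear algebra over a finite field\<close>

lemma scale_mem_subspace_imp_zero: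
  fixes x :: "'a::field ^ 'n::finite"
  assumes "vec.subspace S" "c *s x \<in> S" "x \<notin> S"
  shows "c = 0"
proof (rule ccontr)
  assume "c \<noteq> 0"
  then have "inverse c *s (c *s x) = x" by simp
  then show False using assms vec.subspace_scale by metis
qed

lemma card_span_independent:
  fixes B :: "('a::{field,finite} ^ 'n::finite) set"
  assumes "finite B" "vec.independent B"
  shows "card (vec.span B) = CARD('a) ^ card B"
  using assms
proof (induction rule: finite_induct)
  case empty
  then show ?case by simp
next
  case (insert b B)
  have b: "b \<notin> vec.span B" and ind: "vec.independent B"
    using insert.prems insert.hyps by (simp_all add: vec.independent_insert)
  let ?f = "\<lambda>(c, y). c *s b + y"
  have inj: "inj_on ?f (UNIV \<times> vec.span B)"
  proof (rule inj_onI, clarsimp)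
    fix c d y z assume y: "y \<in> vec.span B" and z: "z \<in> vec.span B"
      and eq: "c *s b + y = d *s b + z"
    have "(c - d) *s b = z - y" using eq by (simp add: vec.scale_left_diff_distrib algebra_simps)
    then have "(c - d) *s b \<in> vec.span B" using y z by (simp add: vec.span_diff)
    then have "c - d = 0" using b scale_mem_subspace_imp_zero vec.subspace_span by blast
    then show "c = d \<and> y = z" using eq by simp
  qed
  have "vec.span (insert b B) = ?f ` (UNIV \<times> vec.span B)"
  proof (intro Set.set_eqI iffI)
    fix x assume "x \<in> vec.span (insert b B)"
    then obtain c where "x - c *s b \<in> vec.span B" by (auto simp: vec.span_insert)
    then show "x \<in> ?f ` (UNIV \<times> vec.span B)"
      by (intro image_eqI[of _ _ "(c, x - c *s b)"]) auto
  next
    fix x assume "x \<in> ?f ` (UNIV \<times> vec.span B)"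
    then obtain c y where "y \<in> vec.span B" "x = c *s b + y" by auto
    then show "x \<in> vec.span (insert b B)"
      by (auto simp: vec.span_insert intro!: exI[of _ c])
  qed
  then have "card (vec.span (insert b B)) = card ((UNIV :: 'a set) \<times> vec.span B)"
    by (simp only: card_image[OF inj])
  also have "\<dots> = CARD('a) * CARD('a) ^ card B"
    by (simp only: card_cartesian_product insert.IH[OF ind])
  finally show ?case using insert.hyps by simp
qed

lemma card_subspace:
  fixes S :: "('a::{field,finite} ^ 'n::finite) set"
  assumes "vec.subspace S"
  shows "card S = CARD('a) ^ vec.dim S"
proof -
  obtain B where "B \<subseteq> S" "vec.independent B" "S \<subseteq> vec.span B" "card B = vec.dim S"
    using vec.basis_exists by blast
  moreover from this have "vec.span B = S" using assms by (simp add: vec.span_subspace)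
  ultimately show ?thesis using card_span_independent[of B] by (metis finite)
qed

lemma dim_1_subspaceE:
  fixes S :: "('a::field ^ 'n::finite) set"
  assumes "vec.subspace S" "vec.dim S = 1"
  obtains p where "p \<noteq> 0" "S = vec.span {p}"
proof -
  obtain B where B: "B \<subseteq> S" "vec.independent B" "S \<subseteq> vec.span B" "card B = 1"
    using vec.basis_exists[of S] assms(2) by auto
  then obtain p where p: "B = {p}" by (auto simp: card_1_singleton_iff)
  then have "p \<noteq> 0" using B(2) vec.dependent_zero by blast
  moreover have "S = vec.span {p}" using B p assms(1) by (metis vec.span_subspace)
  ultimately show thesis by (rule that)
qed

text \<open>The span of \<open>insert x S\<close> has dimension \<open>vec.dim S + 1\<close> and is
  mapped into \<open>S\<close>, so \<open>f\<close> has a kernel. This turns an equation for a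
  matrix that holds at \<open>x\<close> only modulo \<open>S\<close> into one that holds exactly at
  some nonzero vector.\<close>

lemma linear_into_invariant_subspace_not_inj:
  fixes S :: "('a::field ^ 'n::finite) set"
  assumes S: "vec.subspace S" and x: "x \<notin> S"
    and f: "Vector_Spaces.linear (*s) (*s) f" "f x \<in> S" "\<And>y. y \<in> S \<Longrightarrow> f y \<in> S"
  shows "\<exists>y. y \<noteq> 0 \<and> f y = 0"
proof (rule ccontr)
  assume no: "\<not> ?thesis"
  interpret f: Vector_Spaces.linear "(*s)" "(*s)" f by (rule f(1))
  have "inj f" using no by (metis f.inj_iff_eq_0)
  then have "vec.dim (f ` insert x S) = vec.dim (insert x S)"
    using f(1) by (intro vec.dim_image_eq) (auto intro: inj_on_subset)
  moreover have "vec.dim (insert x S) = vec.dim S + 1"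
    using x S by (simp add: vec.dim_insert vec.span_eq_iff[THEN iffD2])
  moreover have "vec.dim (f ` insert x S) \<le> vec.dim S"
    using f by (intro vec.dim_subset) auto
  ultimately show False by simp
qed

section \<open>Cores of subspaces and quadratic matrices\<close>

text \<open>When \<open>s\<close> has no eigenvector, the nonzero \<open>x\<close> in the core are
  those for which the line through \<open>x\<close> and \<open>s *v x\<close> lies in
  \<open>S\<close>.\<close>

definition core :: "'a::field ^ 'n ^ 'n \<Rightarrow> ('a ^ 'n::finite) set \<Rightarrow> ('a ^ 'n) set"
  where "core s S = {x \<in> S. s *v x \<in> S}"

lemma subspace_core: "vec.subspace S \<Longrightarrow> vec.subspace (core s S)"
  unfolding core_def vec.subspace_def
  by (auto simp: matrix_vector_right_distrib vec.scale)

text \<open>For a matrix without eigenvectors, this says that it generates a quadratic extension of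
  the base field.\<close>

definition quadratic :: "'a::field ^ 'n ^ 'n::finite \<Rightarrow> bool"
  where "quadratic s \<longleftrightarrow> (\<exists>a b. \<forall>x. s *v (s *v x) = a *s x + b *s (s *v x))"

text \<open>\<open>U\<close> plays the role of the multiplicative group of the field with
  \<open>CARD('a) ^ CARD('n)\<close> elements acting on itself; field addition is not needed, since maps
  commuting with \<open>U\<close> that vanish at one nonzero vector vanish at all of them.\<close>

locale singer_matrices =
  fixes U :: "('a::{field,finite} ^ 'n ^ 'n::finite) set"
  assumes comm: "M \<in> U \<Longrightarrow> N \<in> U \<Longrightarrow> M ** N = N ** M"
    and mult: "M \<in> U \<Longrightarrow> N \<in> U \<Longrightarrow> M ** N \<in> U"
    and inv: "M \<in> U \<Longrightarrow> \<exists>N\<in>U. N ** M = mat 1"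
    and trans: "x \<noteq> 0 \<Longrightarrow> y \<noteq> 0 \<Longrightarrow> \<exists>M\<in>U. M *v x = y"
begin

section \<open>Consequences of commutativity and transitivity\<close>

lemma comm_vec: "M \<in> U \<Longrightarrow> N \<in> U \<Longrightarrow> M *v (N *v x) = N *v (M *v x)"
  by (simp add: matrix_vector_mul_assoc comm)

lemma inj_vec: "M \<in> U \<Longrightarrow> M *v x = M *v y \<Longrightarrow> x = y"
  using inv[of M] by (metis matrix_vector_mul_assoc matrix_vector_mul_lid)

lemma nonzero: "M \<in> U \<Longrightarrow> x \<noteq> 0 \<Longrightarrow> M *v x \<noteq> 0"
  using inj_vec[of M x 0] by auto

lemma equivariant_zero:
  assumes "\<And>M x. M \<in> U \<Longrightarrow> f (M *v x) = M *v f x" and "f x = 0" "x \<noteq> 0" "y \<noteq> 0"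
  shows "f y = 0"
proof -
  obtain M where "M \<in> U" "M *v x = y" using trans assms by blast
  then show ?thesis using assms(1)[of M x] assms(2) by simp
qed

text \<open>The difference of \<open>M\<close> and \<open>N\<close> commutes with \<open>U\<close>
  and vanishes at \<open>x\<close>, hence everywhere. Together with \<open>trans\<close> this makes
  \<open>U\<close> regular on nonzero vectors, so matrices can be counted by their values at one
  vector.\<close>

lemma eq_if_eq_at:
  assumes "M \<in> U" "N \<in> U" "M *v x = N *v x" "x \<noteq> 0"
  shows "M = N"
proof -
  have "M *v y - N *v y = 0" for y
  proof (cases "y = 0")
    case False
    show ?thesis
      by (rule equivariant_zero[of "\<lambda>y. M *v y - N *v y" x])
        (use assms False in \<open>auto simp: matrix_vector_mult_diff_distrib comm_vec\<close>)
  qed simp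
  then show ?thesis by (simp add: matrix_eq)
qed

text \<open>The map \<open>s - c\<close> commutes with \<open>U\<close>, so a single eigenvector
  already makes \<open>s\<close> scalar.\<close>

lemma eigenvector_everywhere:
  assumes "s \<in> U" "s *v x = c *s x" "x \<noteq> 0" "y \<noteq> 0"
  shows "s *v y = c *s y"
proof -
  have "s *v y - c *s y = 0"
    by (rule equivariant_zero[of "\<lambda>y. s *v y - c *s y" x])
      (use assms in \<open>auto simp: matrix_vector_mult_diff_distrib comm_vec vec.scale\<close>)
  then show ?thesis by simp
qed

lemma quadraticI:
  assumes s: "s \<in> U" and x: "x \<noteq> 0" "s *v (s *v x) = a *s x + b *s (s *v x)"
  shows "quadratic s"
proof -
  have "s *v (s *v y) - (a *s y + b *s (s *v y)) = 0" for y
  proof (cases "y = 0")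
    case False
    show ?thesis
      by (rule equivariant_zero[of "\<lambda>y. s *v (s *v y) - (a *s y + b *s (s *v y))" x])
        (use assms False in \<open>auto simp: matrix_vector_mult_diff_distrib matrix_vector_right_distrib comm_vec vec.scale\<close>)
  qed simp
  then show ?thesis unfolding quadratic_def by (metis eq_iff_diff_eq_0)
qed

end

section \<open>Dimensions of cores\<close>

locale nonscalar_matrix = singer_matrices U
  for U :: "('a::{field,finite} ^ 'n ^ 'n::finite) set" +
  fixes s :: "'a ^ 'n ^ 'n"
  assumes s: "s \<in> U"
    and nonscalar: "x \<noteq> 0 \<Longrightarrow> s *v x \<noteq> c *s x"
begin

text \<open>In effect \<open>W\<close> is a vector space over a quadratic extension field. The
  argument is elementary: take an invariant subspace \<open>X\<close> of even dimension that is
  maximal in \<open>W\<close>; if it missed some \<open>x\<close>, adjoining \<open>x\<close> and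
  \<open>s *v x\<close> would give an invariant subspace larger by two dimensions.\<close>

lemma even_dim_invariant:
  assumes quad: "quadratic s" and W: "vec.subspace W" "\<And>x. x \<in> W \<Longrightarrow> s *v x \<in> W"
  shows "even (vec.dim W)"
proof -
  obtain a b where ab: "s *v (s *v x) = a *s x + b *s (s *v x)" for x
    using quad by (auto simp: quadratic_def)
  define P where "P X \<longleftrightarrow> X \<subseteq> W \<and> vec.subspace X \<and> (\<forall>x\<in>X. s *v x \<in> X) \<and> even (vec.dim X)" for X
  have "P {0}" using W(1) by (auto simp: P_def vec.subspace_0)
  moreover have "finite {X. P X}" by simp
  ultimately obtain X where "P X" and max: "\<And>Y. P Y \<Longrightarrow> \<not> X \<subset> Y"
    using finite_has_maximal[of "{X. P X}"] by (metis empty_iff mem_Collect_eq psubset_eq)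
  then have X: "X \<subseteq> W" "vec.subspace X" "\<And>x. x \<in> X \<Longrightarrow> s *v x \<in> X" "even (vec.dim X)"
    by (auto simp: P_def)
  have spX: "vec.span X = X" using X by (simp add: vec.span_eq_iff)
  have "W \<subseteq> X"
  proof
    fix x assume x: "x \<in> W"
    show "x \<in> X"
    proof (rule ccontr)
      assume xX: "x \<notin> X"
      let ?Y = "vec.span (insert (s *v x) (insert x X))"
      have sx: "s *v x \<notin> vec.span (insert x X)"
      proof
        assume "s *v x \<in> vec.span (insert x X)"
        then obtain c where y: "s *v x - c *s x \<in> X"
          using X by (auto simp: vec.span_insert spX)
        let ?y = "s *v x - c *s x"
        \<comment> \<open>Dividing the quadratic polynomial of \<open>s\<close> by
          \<open>s - c\<close> gives the quotient \<open>s - (b - c)\<close> and a constant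
          remainder. As \<open>?y\<close> lies in \<open>X\<close> and \<open>x\<close> does not,
          the constant vanishes. Then \<open>?y\<close> would be an eigenvector unless it is 0, and
          in that case \<open>x\<close> would be one.\<close>
        have *: "s *v ?y - (b - c) *s ?y = (a + (b - c) * c) *s x"
          by (simp add: ab matrix_vector_mult_diff_distrib vec.scale vec_eq_iff algebra_simps)
        then have "(a + (b - c) * c) *s x = s *v ?y - (b - c) *s ?y" by simp
        moreover have "s *v ?y - (b - c) *s ?y \<in> X"
          by (intro vec.subspace_diff vec.subspace_scale X y)
        ultimately have "a + (b - c) * c = 0"
          using scale_mem_subspace_imp_zero[OF X(2) _ xX] by metis
        then have "s *v ?y = (b - c) *s ?y"
          using * by simp
        then have "?y = 0" using nonscalar by blast
        then show False using nonscalar[of x c] xX X(2) vec.subspace_0 by auto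
      qed
      have "?Y \<subseteq> W" using W x X by (intro vec.span_minimal) auto
      moreover have "s *v z \<in> ?Y" if "z \<in> ?Y" for z
        using that
      proof (induction rule: vec.span_induct_alt)
        case (step c v z)
        have "s *v v \<in> ?Y"
          using step.hyps X(3) by (auto simp: ab intro: vec.span_base intro!: vec.span_add vec.span_scale)
        then show ?case
          using step by (auto simp: matrix_vector_right_distrib vec.scale intro!: vec.span_add vec.span_scale)
      qed (simp add: vec.span_zero)
      moreover have "vec.dim ?Y = vec.dim X + 2"
        using sx xX by (simp add: vec.dim_insert spX)
      ultimately have "P ?Y" using X(4) by (auto simp: P_def)
      moreover have "X \<subset> ?Y"
        using xX by (auto intro: vec.span_base)
      ultimately show False using max by blast
    qed
  qed
  then show ?thesis using X by (metis subset_antisym)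
qed

text \<open>The core is the intersection of \<open>S\<close> with its image under the inverse of
  \<open>s\<close>. Both have the same dimension, and their sum has dimension at most
  \<open>CARD('n)\<close>.\<close>

lemma dim_core_ge:
  assumes S: "vec.subspace S"
  shows "2 * vec.dim S \<le> CARD('n) + vec.dim (core s S)"
proof -
  obtain t where t: "t \<in> U" "t ** s = mat 1" using inv s by blast
  then have ts: "t *v (s *v x) = x" "s *v (t *v x) = x" for x
    using comm[OF t(1) s] by (simp_all add: matrix_vector_mul_assoc)
  let ?T = "(*v) t ` S"
  have T: "vec.subspace ?T" using S by (rule vec.subspace_image)
  have "vec.dim ?T = vec.dim S"
    by (rule vec.dim_image_eq[OF vec.linear_axioms]) (use ts in \<open>metis inj_onI\<close>)
  moreover have "core s S = S \<inter> ?T"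
    unfolding core_def using ts by (force intro: rev_image_eqI)
  moreover have "vec.dim {x + y |x y. x \<in> S \<and> y \<in> ?T} \<le> CARD('n)"
    by (rule dim_subset_UNIV_cart_gen)
  ultimately show ?thesis using vec.dim_sums_Int[OF S T] by simp
qed

text \<open>Here \<open>s\<close> acts on a two-dimensional quotient. For \<open>x\<close> outside
  \<open>S\<close>, either \<open>x\<close> is an eigenvector modulo \<open>S\<close>, which would
  yield a true eigenvector, or \<open>S\<close>, \<open>x\<close> and \<open>s *v x\<close> span
  everything, so that \<open>x\<close> satisfies a quadratic equation modulo \<open>S\<close>. In
  the latter case the equation holds exactly at some nonzero vector and spreads by
  \<open>quadraticI\<close>.\<close>

lemma quadratic_if_core_codim_2:
  assumes S: "vec.subspace S" "core s S = S" and dim: "vec.dim S + 2 = CARD('n)"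
  shows "quadratic s"
proof -
  have spS: "vec.span S = S" using S by (simp add: vec.span_eq_iff)
  have sS: "s *v x \<in> S" if "x \<in> S" for x using S(2) that by (auto simp: core_def)
  have "vec.dim S < vec.dim (UNIV :: ('a ^ 'n) set)" using dim vec_dim_card by (metis less_add_same_cancel1 pos2)
  then obtain x where x: "x \<notin> S" by (metis UNIV_eq_I less_irrefl)
  show ?thesis
  proof (cases "s *v x \<in> vec.span (insert x S)")
    case True
    then obtain c where c: "s *v x - c *s x \<in> S" by (auto simp: vec.span_insert spS)
    have "\<exists>y. y \<noteq> 0 \<and> s *v y - c *s y = 0"
    proof (rule linear_into_invariant_subspace_not_inj[OF S(1) x])
      show "Vector_Spaces.linear (*s) (*s) (\<lambda>y. s *v y - c *s y)"
        by (intro vec.linear_compose_sub vec.linear_axioms vec.linear_scale_self)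
    qed (use c S(1) sS in \<open>auto intro: vec.subspace_diff vec.subspace_scale\<close>)
    then show ?thesis using nonscalar by auto
  next
    case False
    have "vec.dim (insert (s *v x) (insert x S)) = CARD('n)"
      using False x dim by (simp add: vec.dim_insert spS)
    then have "vec.span (insert (s *v x) (insert x S)) = UNIV"
      using vec.dim_eq_span[of "insert (s *v x) (insert x S)" UNIV] vec_dim_card[where 'a='a and 'n='n]
      by simp
    then have "s *v (s *v x) \<in> vec.span (insert (s *v x) (insert x S))" by blast
    then obtain b a where c: "s *v (s *v x) - b *s (s *v x) - a *s x \<in> S"
      unfolding vec.span_insert spS by blast
    have "\<exists>y. y \<noteq> 0 \<and> s *v (s *v y) - b *s (s *v y) - a *s y = 0"
    proof (rule linear_into_invariant_subspace_not_inj[OF S(1) x])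
      show "Vector_Spaces.linear (*s) (*s) (\<lambda>y. s *v (s *v y) - b *s (s *v y) - a *s y)"
        unfolding Vector_Spaces.linear_iff
        by (auto simp: vec.vector_space_axioms matrix_vector_right_distrib vec.scale vec_eq_iff algebra_simps)
    qed (use c S(1) sS in \<open>auto intro!: vec.subspace_diff vec.subspace_scale\<close>)
    then obtain y where "y \<noteq> 0" "s *v (s *v y) = a *s y + b *s (s *v y)"
      by (auto simp: algebra_simps)
    then show ?thesis using quadraticI[OF s] by blast
  qed
qed

text \<open>That \<open>s\<close> maps \<open>s *v u\<close> back into the line is precisely a
  quadratic equation at \<open>u\<close>, and one nonzero vector suffices.\<close>

lemma quadratic_iff_core_line:
  assumes "u \<noteq> 0" "l = vec.span {u, s *v u}"
  shows "quadratic s \<longleftrightarrow> core s l = l"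
proof
  assume "quadratic s"
  then obtain a b where ab: "s *v (s *v x) = a *s x + b *s (s *v x)" for x
    by (auto simp: quadratic_def)
  have "s *v x \<in> l" if "x \<in> l" for x
    using that unfolding assms(2)
  proof (induction rule: vec.span_induct_alt)
    case (step c v z)
    have "s *v v \<in> vec.span {u, s *v u}"
      using step.hyps by (auto simp: ab intro: vec.span_base intro!: vec.span_add vec.span_scale)
    then show ?case
      using step by (auto simp: matrix_vector_right_distrib vec.scale intro!: vec.span_add vec.span_scale)
  qed (simp add: vec.span_zero)
  then show "core s l = l" by (auto simp: core_def)
next
  assume "core s l = l"
  moreover have "s *v u \<in> l" unfolding assms(2) by (rule vec.span_base) simp
  ultimately have "s *v (s *v u) \<in> l" unfolding core_def by blast
  then have "s *v (s *v u) \<in> vec.span {s *v u, u}"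
    unfolding assms(2) by (simp only: insert_commute[of u])
  then obtain b a where "s *v (s *v u) - b *s (s *v u) = a *s u"
    by (auto simp: vec.span_insert vec.span_singleton)
  then have "s *v (s *v u) = a *s u + b *s (s *v u)" by (simp add: algebra_simps)
  then show "quadratic s" using quadraticI[OF s assms(1)] by blast
qed

lemma dim_line:
  assumes "u \<noteq> 0"
  shows "vec.dim (vec.span {u, s *v u}) = 2"
proof -
  have "s *v u \<notin> vec.span {u}" using nonscalar[OF assms] by (auto simp: vec.span_singleton)
  then have "vec.dim (insert (s *v u) {u}) = 2" using assms by (simp add: vec.dim_insert)
  then show ?thesis by (simp add: insert_commute)
qed

text \<open>The core always contains \<open>u\<close>; in the non-quadratic case it is a proper
  subspace of the two-dimensional \<open>l\<close>.\<close>

lemma dim_core_line: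
  assumes "u \<noteq> 0" "l = vec.span {u, s *v u}"
  shows "vec.dim (core s l) = (if quadratic s then 2 else 1)"
proof (cases "quadratic s")
  case True
  then show ?thesis using quadratic_iff_core_line[OF assms] dim_line assms by simp
next
  case False
  have l: "vec.subspace l" using assms by simp
  have "vec.span {u} \<subseteq> core s l"
    using assms by (intro vec.span_minimal subspace_core l) (auto simp: core_def vec.span_base)
  then have "1 \<le> vec.dim (core s l)"
    using vec.dim_subset[of "vec.span {u}" "core s l"] assms(1) by simp
  moreover have "core s l \<subset> l"
    using False quadratic_iff_core_line[OF assms] by (auto simp: core_def)
  then have "vec.dim (core s l) < vec.dim l"
    using l subspace_core[OF l] by (metis vec.dim_psubset vec.span_eq_iff)
  ultimately show ?thesis using False dim_line assms by simp
qed

lemma dim_core_codim_2: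
  assumes S: "vec.subspace S" and dim: "vec.dim S + 2 = CARD('n)"
  shows "vec.dim (core s S) + 2 = vec.dim S \<or>
    vec.dim (core s S) + (if quadratic s then 0 else 1) = vec.dim S"
proof -
  have ge: "vec.dim S \<le> vec.dim (core s S) + 2" using dim_core_ge[OF S] dim by simp
  have le: "vec.dim (core s S) \<le> vec.dim S" by (rule vec.dim_subset) (auto simp: core_def)
  show ?thesis
  proof (cases "quadratic s")
    case True
    have "s *v x \<in> core s S" if "x \<in> core s S" for x
    proof -
      obtain a b where "s *v (s *v x) = a *s x + b *s (s *v x)"
        using True by (auto simp: quadratic_def)
      then show ?thesis
        using that S by (auto simp: core_def intro!: vec.subspace_add vec.subspace_scale)
    qed
    then have "even (vec.dim (core s S))"
      using even_dim_invariant[OF True subspace_core[OF S]] by blast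
    \<comment> \<open>The whole space is also invariant, so \<open>vec.dim S\<close> is even too and
      the codimension of the core in \<open>S\<close> cannot be 1.\<close>
    moreover have "even CARD('n)"
      using even_dim_invariant[OF True vec.subspace_UNIV] vec_dim_card[where 'a='a and 'n='n] by simp
    then have "even (vec.dim S)" using dim by (metis even_add even_numeral)
    ultimately obtain i j where "vec.dim (core s S) = 2 * i" "vec.dim S = 2 * j"
      by (auto elim!: evenE)
    then show ?thesis using ge le True by auto
  next
    case False
    then have "core s S \<subset> S" using quadratic_if_core_codim_2[OF S _ dim] by (auto simp: core_def)
    then have "vec.dim (core s S) < vec.dim S"
      using S subspace_core[OF S] by (metis vec.dim_psubset vec.span_eq_iff)
    then show ?thesis using ge False by auto
  qed
qed

section \<open>Counting images of a line\<close>

text \<open>By commutativity \<open>M\<close> maps \<open>l\<close> to the span of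
  \<open>M *v u\<close> and \<open>s *v (M *v u)\<close>, which lies in \<open>S\<close> exactly
  when \<open>M *v u\<close> is in the core. Regularity makes \<open>M\<close> correspond to
  \<open>M *v u\<close>.\<close>

lemma card_images_in_subspace:
  assumes u: "u \<noteq> 0" "l = vec.span {u, s *v u}" and S: "vec.subspace S"
  shows "card {M \<in> U. (*v) M ` l \<subseteq> S} = CARD('a) ^ vec.dim (core s S) - 1"
proof -
  have iff: "(*v) M ` l \<subseteq> S \<longleftrightarrow> M *v u \<in> core s S" if M: "M \<in> U" for M
  proof -
    have "(*v) M ` l = vec.span {M *v u, s *v (M *v u)}"
      unfolding u(2) by (simp flip: vec.span_image add: comm_vec[OF M s])
    also have "\<dots> \<subseteq> S \<longleftrightarrow> {M *v u, s *v (M *v u)} \<subseteq> S"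
      using S vec.span_minimal vec.span_superset subset_trans by meson
    finally show ?thesis by (auto simp: core_def)
  qed
  have "bij_betw (\<lambda>M. M *v u) {M \<in> U. (*v) M ` l \<subseteq> S} (core s S - {0})"
    unfolding bij_betw_def
  proof
    show "inj_on (\<lambda>M. M *v u) {M \<in> U. (*v) M ` l \<subseteq> S}"
      using eq_if_eq_at u(1) by (auto intro!: inj_onI)
    show "(\<lambda>M. M *v u) ` {M \<in> U. (*v) M ` l \<subseteq> S} = core s S - {0}"
    proof (intro Set.set_eqI iffI)
      fix y assume y: "y \<in> core s S - {0}"
      then obtain M where "M \<in> U" "M *v u = y" using trans[OF u(1)] by auto
      then show "y \<in> (\<lambda>M. M *v u) ` {M \<in> U. (*v) M ` l \<subseteq> S}" using iff[of M] y by auto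
    qed (use iff nonzero[OF _ u(1)] in auto)
  qed
  then have "card {M \<in> U. (*v) M ` l \<subseteq> S} = card (core s S - {0})"
    by (rule bij_betw_same_card)
  then show ?thesis
    using card_subspace[OF subspace_core[OF S]] vec.subspace_0[OF subspace_core[OF S]]
    by (simp add: card_Diff_singleton)
qed

text \<open>For each nonzero \<open>x\<close> in \<open>l\<close> exactly one matrix of
  \<open>U\<close> takes \<open>x\<close> to \<open>p\<close>, and different \<open>x\<close> give
  different matrices.\<close>

lemma card_images_through:
  assumes l: "vec.subspace l" and p: "p \<noteq> 0"
  shows "card {M \<in> U. p \<in> (*v) M ` l} = CARD('a) ^ vec.dim l - 1"
proof -
  obtain g where g: "\<And>x. x \<noteq> 0 \<Longrightarrow> g x \<in> U \<and> g x *v x = p"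
    using trans[OF _ p] by metis
  have "bij_betw g (l - {0}) {M \<in> U. p \<in> (*v) M ` l}"
    unfolding bij_betw_def
  proof
    show "inj_on g (l - {0})" using g inj_vec by (intro inj_onI) (metis Diff_iff singletonI)
    show "g ` (l - {0}) = {M \<in> U. p \<in> (*v) M ` l}"
    proof (intro Set.set_eqI iffI)
      fix M assume "M \<in> {M \<in> U. p \<in> (*v) M ` l}"
      then obtain x where x: "M \<in> U" "x \<in> l" "M *v x = p" by auto
      then have "x \<noteq> 0" using p by auto
      then show "M \<in> g ` (l - {0})" using x g eq_if_eq_at[of M "g x" x] by auto
    next
      fix M assume "M \<in> g ` (l - {0})"
      then obtain x where "x \<in> l" "x \<noteq> 0" "M = g x" by auto
      then show "M \<in> {M \<in> U. p \<in> (*v) M ` l}" using g[of x] by (auto intro!: image_eqI[of p _ x])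
    qed
  qed
  then have "card {M \<in> U. p \<in> (*v) M ` l} = card (l - {0})"
    by (rule bij_betw_same_card[symmetric])
  then show ?thesis
    using card_subspace[OF l] vec.subspace_0[OF l] by (simp add: card_Diff_singleton)
qed

text \<open>Orbit-stabilizer counting: every fibre of the map from \<open>M\<close> to the image of
  \<open>l\<close> is a translate of the stabilizer of \<open>l\<close>. The predicate
  \<open>Q\<close> is left free so that lines through a point and lines inside a subspace are both
  covered.\<close>

lemma card_stabilizer_mult:
  assumes u: "u \<noteq> 0" "l = vec.span {u, s *v u}"
  shows "card {M \<in> U. Q ((*v) M ` l)} =
    (CARD('a) ^ vec.dim (core s l) - 1) * card {k \<in> (\<lambda>M. (*v) M ` l) ` U. Q k}"
proof -
  let ?f = "\<lambda>M. (*v) M ` l"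
  have fibre: "card {M \<in> U. ?f M = ?f A} = CARD('a) ^ vec.dim (core s l) - 1" if A: "A \<in> U" for A
  proof -
    obtain B where B: "B \<in> U" "B ** A = mat 1" using inv A by blast
    then have AB: "A ** B = mat 1" using comm A by metis
    have inj: "inj ((*v) M)" if "M \<in> U" for M using inj_vec[OF that] by (auto intro: injI)
    have f: "?f (M ** N) = (*v) M ` ?f N" for M N :: "'a ^ 'n ^ 'n"
      by (auto simp: matrix_vector_mul_assoc image_image)
    have "bij_betw ((**) A) {M \<in> U. ?f M \<subseteq> l} {M \<in> U. ?f M = ?f A}"
    proof (rule bij_betw_byWitness[where f' = "(**) B"])
      show "(**) A ` {M \<in> U. ?f M \<subseteq> l} \<subseteq> {M \<in> U. ?f M = ?f A}"
      proof clarify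
        fix M assume M: "M \<in> U" "?f M \<subseteq> l"
        \<comment> \<open>An injective map of a finite set into itself is onto.\<close>
        then have "?f M = l"
          using inj[OF M(1)] by (metis endo_inj_surj finite inj_on_subset top_greatest)
        then show "A ** M \<in> U \<and> ?f (A ** M) = ?f A" using M mult A by (simp add: f)
      qed
      show "(**) B ` {M \<in> U. ?f M = ?f A} \<subseteq> {M \<in> U. ?f M \<subseteq> l}"
      proof clarify
        fix M assume M: "M \<in> U" "?f M = ?f A"
        have "?f (B ** M) = ?f (B ** A)" using M by (simp add: f)
        then show "B ** M \<in> U \<and> ?f (B ** M) \<subseteq> l" using M mult B by simp
      qed
    qed (simp_all add: matrix_mul_assoc B AB)
    then have "card {M \<in> U. ?f M = ?f A} = card {M \<in> U. ?f M \<subseteq> l}"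
      by (rule bij_betw_same_card[symmetric])
    also have "\<dots> = CARD('a) ^ vec.dim (core s l) - 1"
      by (rule card_images_in_subspace[OF u]) (simp add: u(2))
    finally show ?thesis .
  qed
  have "{M \<in> U. Q (?f M)} = (\<Union>k\<in>{k \<in> ?f ` U. Q k}. {M \<in> U. ?f M = k})" by auto
  also have "card \<dots> = (\<Sum>k\<in>{k \<in> ?f ` U. Q k}. card {M \<in> U. ?f M = k})"
    by (rule card_UN_disjoint) auto
  also have "\<dots> = (\<Sum>k\<in>{k \<in> ?f ` U. Q k}. CARD('a) ^ vec.dim (core s l) - 1)"
    using fibre by (intro sum.cong) auto
  finally show ?thesis by simp
qed

section \<open>The cover parameters\<close>

lemma dual_cover_images_of_line:
  assumes u: "u \<noteq> 0" "l = vec.span {u, s *v u}" and r: "r \<ge> 3" "CARD('n) = r + 1"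
  shows "dual_cover r CARD('a) ((\<lambda>M. (*v) M ` l) ` U)"
proof -
  let ?L = "(\<lambda>M. (*v) M ` l) ` U"
  define q where "q = CARD('a)"
  define e where "e = vec.dim (core s l)"
  \<comment> \<open>This is \<open>(q ^ 2 - 1) / (q ^ e - 1)\<close>: the matrices taking
    \<open>l\<close> to a line through a given point, divided by the order of the stabilizer of
    \<open>l\<close>.\<close>
  define m where "m = (if quadratic s then 1 else q + 1)"
  have q: "q \<ge> 2"
  proof -
    have "card {0, 1 :: 'a} \<le> q" unfolding q_def by (rule card_mono) auto
    then show ?thesis by simp
  qed
  have e: "e = (if quadratic s then 2 else 1)" unfolding e_def by (rule dim_core_line[OF u])
  have em: "(real q ^ e - 1) * real m = real q ^ 2 - 1"
    by (simp add: e m_def power2_eq_square algebra_simps)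
  have qe: "real q ^ e - 1 \<noteq> 0" using q e by (auto simp: power2_eq_1_iff)
  have count: "(real q ^ e - 1) * real (card {k \<in> ?L. Q k}) = real q ^ d - 1"
    if "card {M \<in> U. Q ((*v) M ` l)} = q ^ d - 1" for Q d
  proof -
    have "(q ^ e - 1) * card {k \<in> ?L. Q k} = q ^ d - 1"
      using card_stabilizer_mult[OF u, of Q] that by (simp add: q_def e_def)
    then have "real (q ^ e - 1) * real (card {k \<in> ?L. Q k}) = real (q ^ d - 1)"
      unfolding of_nat_mult[symmetric] by (rule arg_cong)
    then show ?thesis using q by (simp add: of_nat_diff)
  qed
  have l: "vec.subspace l" "vec.dim l = 2" using u dim_line[OF u(1)] by simp_all
  have sub: "vec.subspace ((*v) M ` l)" for M :: "'a ^ 'n ^ 'n" using l(1) by (rule vec.subspace_image)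
  have lines: "?L \<subseteq> pg_lines"
  proof clarify
    fix M assume "M \<in> U"
    then have "inj_on ((*v) M) (vec.span l)" using inj_vec by (auto intro!: inj_onI)
    then have "vec.dim ((*v) M ` l) = 2" using l vec.dim_image_eq[OF vec.linear_axioms] by metis
    then show "(*v) M ` l \<in> pg_lines" using sub by (simp add: pg_spaces_def)
  qed
  have points: "card {k \<in> ?L. P \<subseteq> k} = m" if P: "P \<in> pg_points" for P
  proof -
    obtain p where p: "p \<noteq> 0" "P = vec.span {p}"
      using P by (auto simp: pg_spaces_def elim: dim_1_subspaceE)
    have "P \<subseteq> (*v) M ` l \<longleftrightarrow> p \<in> (*v) M ` l" for M :: "'a ^ 'n ^ 'n"
      using p sub[of M] vec.span_base[of p "{p}"] vec.span_minimal[of "{p}" "(*v) M ` l"] by blast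
    then have "card {M \<in> U. P \<subseteq> (*v) M ` l} = q ^ 2 - 1"
      using card_images_through[OF l(1) p(1)] l(2) by (simp add: q_def)
    then have "(real q ^ e - 1) * real (card {k \<in> ?L. P \<subseteq> k}) = (real q ^ e - 1) * real m"
      using count[of "\<lambda>k. P \<subseteq> k" 2] em by metis
    then show ?thesis using qe by simp
  qed
  \<comment> \<open>As \<open>r\<close> is at least 3, the sum on the right includes
    \<open>1 + q + q ^ 2\<close>, which exceeds \<open>q + 1\<close>.\<close>
  have "m < theta (int r - 1) q"
  proof -
    have "m \<le> q + 1" by (simp add: m_def)
    also have "\<dots> < (\<Sum>i<3. q ^ i)" using q by (simp add: eval_nat_numeral)
    also have "\<dots> \<le> (\<Sum>i<r. q ^ i)" using r by (intro sum_mono2) auto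
    finally show ?thesis by (simp add: theta_def)
  qed
  then have cover: "m_cover r q m ?L"
    using lines points by (simp add: m_cover_def m_def)
  have "real (card {k \<in> ?L. k \<subseteq> S}) =
      real m * real (theta (int r - 4) q) / (real q + 1) + real q ^ (r - 3) \<or>
    real (card {k \<in> ?L. k \<subseteq> S}) =
      real m * real (theta (int r - 4) q) / (real q + 1)" if S: "S \<in> pg_spaces (r - 2)" for S
  proof -
    let ?c = "real (card {k \<in> ?L. k \<subseteq> S})" and ?t = "real (theta (int r - 4) q)"
    define d where "d = vec.dim (core s S)"
    have S: "vec.subspace S" "vec.dim S = r - 1" using S r(1) by (simp_all add: pg_spaces_def)
    have c: "(real q ^ e - 1) * ?c = real q ^ d - 1"
      using count[of "\<lambda>k. k \<subseteq> S" d] card_images_in_subspace[OF u S(1)] by (simp add: q_def d_def)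
    obtain n where n: "r = n + 3" using r(1) by (metis add.commute le_Suc_ex)
    \<comment> \<open>With \<open>n = r - 3\<close> the sum in \<open>theta\<close> has
      \<open>n\<close> terms; for \<open>r = 3\<close> it is empty and both sides are 0.\<close>
    have t: "(real q - 1) * ?t = real q ^ n - 1"
      using power_diff_1_eq[of "real q" n] by (simp add: theta_def n nat_add_distrib)
    have d: "d = n \<or> d = (if quadratic s then n + 2 else n + 1)"
      using dim_core_codim_2[OF S(1)] S(2) r n by (auto simp: d_def split: if_splits)
    \<comment> \<open>The excess over the smaller of the two permitted line counts.\<close>
    define w where "w = (if d = n then 0 else real q ^ n)"
    have "(real q ^ e - 1) * (real m * ?t) = (real q ^ e - 1) * real m * ?t" by simp
    also have "\<dots> = (real q + 1) * ((real q - 1) * ?t)"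
      unfolding em by (simp add: power2_eq_square algebra_simps)
    also have "\<dots> = (real q + 1) * (real q ^ n - 1)" by (simp only: t)
    finally have mt: "(real q ^ e - 1) * (real m * ?t) = (real q + 1) * (real q ^ n - 1)" .
    \<comment> \<open>If \<open>d\<close> is not \<open>n\<close>, then \<open>d = n + e\<close> in
      both the quadratic and the non-quadratic case, and
      \<open>q ^ (n + e) - q ^ n = (q ^ e - 1) * q ^ n\<close>.\<close>
    have qd: "real q ^ d - 1 = (real q ^ n - 1) + (real q ^ e - 1) * w"
      using d by (auto simp: e w_def power_add power2_eq_square algebra_simps)
    have "(real q ^ e - 1) * ((real q + 1) * ?c) = (real q + 1) * ((real q ^ e - 1) * ?c)"
      by (rule mult.left_commute)
    also have "\<dots> = (real q ^ e - 1) * (real m * ?t + (real q + 1) * w)"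
      unfolding c qd distrib_left mt by (simp add: mult.left_commute[of "real q + 1"])
    finally have "(real q + 1) * ?c = real m * ?t + (real q + 1) * w"
      by (rule mult_left_cancel[OF qe, THEN iffD1])
    then have "?c = real m * ?t / (real q + 1) + w"
      by (simp add: field_simps)
    then show ?thesis using n by (auto simp: w_def split: if_splits)
  qed
  then have "dual_m_cover r q m ?L" using cover by (simp add: dual_m_cover_def)
  then show ?thesis unfolding dual_cover_def q_def by blast
qed

end

section \<open>From Singer cyclic groups to matrices\<close>

lemma mat_mult_commute: "mat c ** A = A ** mat c" for A :: "'a::field ^ 'n ^ 'n::finite"
  by (simp add: mat_mult_left mat_mult_right)

text \<open>If \<open>K\<close> is generated by the class of \<open>A\<close>, the matrices over
  \<open>K\<close> are the nonzero multiples of powers of \<open>A\<close>, so they commute.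
  Transitivity on points becomes transitivity on nonzero vectors after adjusting by a
  scalar.\<close>

lemma singer_matrices_Union:
  fixes K :: "('a::{field,finite} ^ 'n ^ 'n::finite) set set"
  assumes K: "singer_cyclic_group K"
  shows "singer_matrices (\<Union>K)"
proof -
  interpret G: Group.group "GL :: ('a ^ 'n ^ 'n) monoid" by (rule group_GL)
  interpret P: Group.group "PGL :: ('a ^ 'n ^ 'n) set monoid" by (rule group_PGL)
  have sub: "subgroup K PGL" and cyc: "cyclic_group (PGL\<lparr>carrier := K\<rparr>)"
    and regular: "\<And>P Q. P \<in> pg_points \<Longrightarrow> Q \<in> pg_points \<Longrightarrow> \<exists>!g. g \<in> K \<and> pgl_act g P = Q"
    using K by (auto simp: singer_cyclic_group_def)
  interpret H: Group.group "PGL\<lparr>carrier := K\<rparr>" using sub by (rule P.subgroup_imp_group)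
  define coset where "coset B = scalars #>\<^bsub>GL\<^esub> B" for B :: "'a ^ 'n ^ 'n"
  have coset: "coset B = {mat c ** B | c. c \<noteq> 0}" for B
    by (auto simp: coset_def r_coset_def scalars_def GL_def)
  have hom: "coset \<in> hom GL PGL"
    unfolding coset_def PGL_def by (rule normal.r_coset_hom_Mod[OF normal_scalars])
  obtain X where X: "X \<in> K" "K = range (\<lambda>n::int. X [^]\<^bsub>PGL\<lparr>carrier := K\<rparr>\<^esub> n)"
    using cyc by (auto simp: H.cyclic_group)
  have "X \<in> carrier PGL" using X(1) sub subgroup.subset by blast
  then obtain A where A: "A \<in> carrier GL" "X = coset A"
    by (auto simp: PGL_def carrier_FactGroup coset_def)
  have "X [^]\<^bsub>PGL\<lparr>carrier := K\<rparr>\<^esub> n = coset (A [^]\<^bsub>GL\<^esub> n)" for n :: int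
    using P.int_pow_consistent[OF sub X(1)] hom_int_pow[OF hom A(1) group_GL group_PGL] A(2) by simp
  then have K_eq: "K = range (\<lambda>n::int. coset (A [^]\<^bsub>GL\<^esub> n))" using X(2) by simp
  have UI: "mat c ** A [^]\<^bsub>GL\<^esub> n \<in> \<Union>K" if "c \<noteq> 0" for c and n :: int
    using that by (auto simp: K_eq coset)
  have UE: "\<exists>c n. c \<noteq> 0 \<and> M = mat c ** A [^]\<^bsub>GL\<^esub> (n::int)" if "M \<in> \<Union>K" for M
    using that by (auto simp: K_eq coset)
  have pow: "A [^]\<^bsub>GL\<^esub> n ** A [^]\<^bsub>GL\<^esub> k = A [^]\<^bsub>GL\<^esub> (n + k)" for n k :: int
    using G.int_pow_mult[OF A(1)] by (simp add: GL_def)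
  have prod: "(mat c ** A [^]\<^bsub>GL\<^esub> n) ** (mat d ** A [^]\<^bsub>GL\<^esub> k) = mat (c * d) ** A [^]\<^bsub>GL\<^esub> (n + k)"
    for c d and n k :: int
  proof -
    let ?A = "\<lambda>n::int. A [^]\<^bsub>GL\<^esub> n"
    have "(mat c ** ?A n) ** (mat d ** ?A k) = mat c ** (?A n ** mat d) ** ?A k"
      by (simp only: matrix_mul_assoc)
    also have "\<dots> = (mat c ** mat d) ** (?A n ** ?A k)"
      by (simp only: mat_mult_commute[of d, symmetric] matrix_mul_assoc)
    finally show ?thesis by (simp only: mat_mult_mat pow)
  qed
  have pow0: "A [^]\<^bsub>GL\<^esub> (0::int) = mat 1"
    by (simp add: int_pow_def2) (simp add: GL_def)
  show ?thesis
  proof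
    fix M N assume "M \<in> \<Union>K" "N \<in> \<Union>K"
    then obtain c d and n k :: int where "c \<noteq> 0" "M = mat c ** A [^]\<^bsub>GL\<^esub> n" "d \<noteq> 0" "N = mat d ** A [^]\<^bsub>GL\<^esub> k"
      using UE by meson
    then show "M ** N = N ** M" "M ** N \<in> \<Union>K"
      by (simp_all only: prod mult.commute[of d] add.commute[of k] UI mult_eq_0_iff not_False_eq_True de_Morgan_disj simp_thms)
  next
    fix M assume "M \<in> \<Union>K"
    then obtain c and n :: int where c: "c \<noteq> 0" "M = mat c ** A [^]\<^bsub>GL\<^esub> n"
      using UE by meson
    then have "(mat (inverse c) ** A [^]\<^bsub>GL\<^esub> (- n)) ** M = mat 1"
      by (simp add: prod pow0 del: int_pow_0)
    moreover have "mat (inverse c) ** A [^]\<^bsub>GL\<^esub> (- n) \<in> \<Union>K"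
      using c(1) by (intro UI) simp
    ultimately show "\<exists>N\<in>\<Union>K. N ** M = mat 1" by blast
  next
    fix x y :: "'a ^ 'n" assume xy: "x \<noteq> 0" "y \<noteq> 0"
    then have "vec.span {x} \<in> pg_points" "vec.span {y} \<in> pg_points" by (simp_all add: pg_spaces_def)
    then obtain g where g: "g \<in> K" "pgl_act g (vec.span {x}) = vec.span {y}"
      using regular by blast
    then obtain n where gn: "g = coset (A [^]\<^bsub>GL\<^esub> (n::int))" by (auto simp: K_eq)
    have "y \<in> pgl_act g (vec.span {x})" using g vec.span_base by auto
    then obtain M k where M: "M \<in> g" "y = M *v (k *s x)"
      by (auto simp: pgl_act_def vec.span_singleton)
    then have k: "k \<noteq> 0" using xy by auto
    obtain c where c: "c \<noteq> 0" "M = mat c ** A [^]\<^bsub>GL\<^esub> n" using M gn by (auto simp: coset)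
    \<comment> \<open>The matrix \<open>M\<close> takes \<open>k *s x\<close>, not \<open>x\<close>,
      to \<open>y\<close>; scaling \<open>M\<close> by \<open>k\<close> corrects this without
      leaving the coset.\<close>
    have "mat (k * c) ** A [^]\<^bsub>GL\<^esub> n \<in> \<Union>K" using c k by (intro UI) simp
    moreover have "mat (k * c) ** A [^]\<^bsub>GL\<^esub> n = mat k ** M"
      unfolding c(2) matrix_mul_assoc mat_mult_mat ..
    moreover have "(mat k ** M) *v x = y"
      using M(2) by (simp add: mat_mult_left matrix_vector_mult_def vec_eq_iff ac_simps)
    ultimately show "\<exists>M\<in>\<Union>K. M *v x = y" by metis
  qed
qed

text \<open>Each coset is nonempty and all its matrices act alike on subspaces, so running over
  matrices instead of cosets gives the same set of images.\<close>

lemma orbit_eq_images: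
  fixes K :: "('a::field ^ 'n ^ 'n::finite) set set"
  assumes K: "K \<subseteq> carrier PGL" and l: "vec.subspace l"
  shows "orbit (PGL\<lparr>carrier := K\<rparr>) pgl_act l = (\<lambda>M. (*v) M ` l) ` \<Union>K"
proof -
  interpret G: Group.group "GL :: ('a ^ 'n ^ 'n) monoid" by (rule group_GL)
  have act: "pgl_act g l = (*v) M ` l" if "g \<in> K" "M \<in> g" for g M
    using pgl_act_coset K l that by blast
  have "\<exists>M. M \<in> g" if "g \<in> K" for g
    using that K G.rcos_self[OF _ normal_imp_subgroup[OF normal_scalars]]
    by (auto simp: PGL_def carrier_FactGroup)
  then show ?thesis using act by (fastforce simp: orbit_def)
qed

theorem lemma2p4:
  fixes r q :: nat
    and L :: "('a::{field,finite} ^ 'n::finite) set set"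
  assumes "r \<ge> 3"
    and "CARD('n) = r + 1"
    and "CARD('a) = q"
    and "singer_cover L"
  shows "dual_cover r q L"
proof -
  obtain K l where K: "singer_cyclic_group K" and l: "l \<in> pg_lines"
    and L: "L = orbit (PGL\<lparr>carrier := K\<rparr>) pgl_act l"
    using assms(4) by (auto simp: singer_cover_def)
  have "K \<subseteq> carrier PGL" using K by (simp add: singer_cyclic_group_def subgroup.subset)
  moreover have l_sub: "vec.subspace l" and l_dim: "vec.dim l = 2"
    using l by (simp_all add: pg_spaces_def)
  ultimately have L: "L = (\<lambda>M. (*v) M ` l) ` \<Union>K"
    unfolding L by (intro orbit_eq_images)
  interpret singer_matrices "\<Union>K" using K by (rule singer_matrices_Union)
  obtain B where B: "B \<subseteq> l" "vec.independent B" "l \<subseteq> vec.span B" "card B = vec.dim l"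
    using vec.basis_exists by blast
  then obtain u v where uv: "B = {v, u}" "v \<noteq> u"
    unfolding l_dim card_2_iff by blast
  then have u: "u \<noteq> 0" "v \<noteq> 0" using B(2) vec.dependent_zero by blast+
  have v: "v \<notin> vec.span {u}" using B(2) uv vec.independent_insert[of v "{u}"] by simp
  have "l = vec.span {v, u}"
    using vec.span_subspace[OF B(1,3) l_sub] uv(1) by simp
  then have l_eq: "l = vec.span {u, v}" by (simp only: insert_commute)
  \<comment> \<open>Transitivity on nonzero vectors supplies the matrix that puts \<open>l\<close>
    in the form of a span of \<open>u\<close> and \<open>s *v u\<close>.\<close>
  obtain s where sK: "s \<in> \<Union>K" and su: "s *v u = v" using trans u by blast
  interpret nonscalar_matrix "\<Union>K" s
  proof
    fix x :: "'a ^ 'n" and c assume x: "x \<noteq> 0"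
    show "s *v x \<noteq> c *s x"
    proof
      assume "s *v x = c *s x"
      \<comment> \<open>An eigenvector anywhere would make \<open>u\<close> one as well,
        contradicting the independence of \<open>u\<close> and \<open>v\<close>.\<close>
      then have "v = c *s u" using eigenvector_everywhere[OF sK _ x u(1)] su by simp
      then show False using v vec.span_scale vec.span_base by blast
    qed
  qed (rule sK)
  show ?thesis
    using dual_cover_images_of_line[OF u(1) _ assms(1,2)] l_eq unfolding L assms(3) su by blast
qed

end
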